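(* Let $N\ge1$ and let $K:\mathbb{F}_N^+\times\mathbb{F}_N^+\to\mathbb{C}$. Then $K=K_\phi$ for some q-positive linear functional $\phi$ on $\mathcal{R}(\mathcal{A}_O^N)$ if and only if $K$ is an invariant kernel.
   Context: $\mathbb{F}_N^+$ is the unital free semigroup on generators $1,\dots,N$. $\mathcal{P}_{2N}$ is the algebra of complex polynomials in noncommuting variables $X_1,\dots,X_{2N}$, with the conjugate-linear anti-multiplicative involution $^+$ determined by $X_k^+=X_{N+k}$ for $1\le k\le N$ and $X_l^+=X_{l-N}$ for $N<l\le2N$. $\mathcal{P}_N\subset\mathcal{P}_{2N}$ is the subalgebra generated by $X_1,\dots,X_N$. For $\sigma=i_1\cdots i_k\in\mathbb{F}_N^+$, $X_\sigma=X_{i_1}\cdots X_{i_k}$ ($X_\emptyset=1$). $\mathcal{A}_O^N=\{1-X_k^+X_k\mid k=1,\dots,N\}$, $\mathcal{R}(\mathcal{A}_O^N)$ is the quotient of $\mathcal{P}_{2N}$ by the two-sided ideal generated by $\mathcal{A}_O^N$, $\pi:\mathcal{P}_{2N}\to\mathcal{R}(\mathcal{A}_O^N)$ is the quotient map, and $\mathcal{R}(\mathcal{A}_O^N)$ carries the involution $\pi(P)^+=\pi(P^+)$. A linear functional $\phi$ on $\mathcal{R}(\mathcal{A}_O^N)$ is q-positive if $\phi(\pi(P)^+\pi(P))\ge0$ for all $P\in\mathcal{P}_N$. The elements $\pi(X_\sigma)$, $\sigma\in\mathbb{F}_N^+$, are linearly independent, and the moment kernel of $\phi$ is $K_\phi(\sigma,\tau)=\phi(\pi(X_\sigma)^+\pi(X_\tau))$,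 $\sigma,\tau\in\mathbb{F}_N^+$. A kernel $K$ on $\mathbb{F}_N^+$ is called invariant if it is positive definite (i.e. $\sum_{p,q}K(\sigma_p,\sigma_q)\overline{c_p}c_q\ge0$ for all finite families $\sigma_p\in\mathbb{F}_N^+$, $c_p\in\mathbb{C}$) and $K(\tau\sigma,\tau\sigma')=K(\sigma,\sigma')$ for all $\tau,\sigma,\sigma'\in\mathbb{F}_N^+$. *)

theory Defs
  imports Complex_Main "HOL-Library.Poly_Mapping" "HOL-Library.Nonpos_Ints"
begin

text \<open>
  The index set of the generators is a type \<open>'n\<close> (a finite type with \<open>N\<close> elements in the
  theorem), and the free unital semigroup on it is \<open>'n list\<close> under concatenation.

  The theory \<open>Poly_Mapping\<close> builds the monoid algebra with convolution product over a monoid that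
  is written additively, so concatenation of words has to be called \<open>+\<close> and the empty word \<open>0\<close>.
\<close>

instantiation list :: (type) monoid_add
begin

definition zero_list :: "'a list" where "zero_list = []"

definition plus_list :: "'a list \<Rightarrow> 'a list \<Rightarrow> 'a list" where "plus_list = (@)"

instance by standard (simp_all add: zero_list_def plus_list_def)

end

text \<open>
  Noncommuting complex polynomials in \<open>2N\<close> variables: \<open>Inl k\<close> stands for the index \<open>k\<close> and
  \<open>Inr k\<close> for the index \<open>N + k\<close>, where \<open>1 \<le> k \<le> N\<close>.
\<close>

type_synonym 'n ncpoly = "('n + 'n) list \<Rightarrow>\<^sub>0 complex"

definition ncvar :: "'n + 'n \<Rightarrow> 'n ncpoly"
  where "ncvar i = Poly_Mapping.single [i] 1"

definition ncscale :: "complex \<Rightarrow> 'n ncpoly \<Rightarrow> 'n ncpoly"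
  where "ncscale c P = Poly_Mapping.single [] c * P"

fun swap_index :: "'n + 'n \<Rightarrow> 'n + 'n" where
  "swap_index (Inl k) = Inr k"
| "swap_index (Inr k) = Inl k"

lemma swap_index_swap_index [simp]: "swap_index (swap_index i) = i"
  by (cases i) auto

definition adj_word :: "('n + 'n) list \<Rightarrow> ('n + 'n) list"
  where "adj_word w = rev (map swap_index w)"

lemma adj_word_adj_word [simp]: "adj_word (adj_word w) = w"
  by (simp add: adj_word_def rev_map o_def)

lemma adj_word_add: "adj_word (v + w) = adj_word w + adj_word v"
  by (simp add: adj_word_def plus_list_def)

text \<open>
  The involution \<open>P \<mapsto> P\<^sup>+\<close>. That it is the conjugate-linear anti-multiplicative involution
  exchanging the variables \<open>X\<^sub>k\<close> and \<open>X\<^bsub>N+k\<^esub>\<close> is shown in the lemmas that follow.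
\<close>

lift_definition ncadj :: "'n ncpoly \<Rightarrow> 'n ncpoly" is "\<lambda>p w. cnj (p (adj_word w))"
proof -
  fix p :: "('n + 'n) list \<Rightarrow> complex"
  assume "finite {w. p w \<noteq> 0}"
  moreover have "{w. cnj (p (adj_word w)) \<noteq> 0} \<subseteq> adj_word ` {w. p w \<noteq> 0}"
  proof
    fix w assume "w \<in> {w. cnj (p (adj_word w)) \<noteq> 0}"
    then show "w \<in> adj_word ` {w. p w \<noteq> 0}"
      by (intro image_eqI[of _ _ "adj_word w"]) auto
  qed
  ultimately show "finite {w. cnj (p (adj_word w)) \<noteq> 0}"
    by (meson finite_imageI finite_subset)
qed

lemma ncadj_single: "ncadj (Poly_Mapping.single w c) = Poly_Mapping.single (adj_word w) (cnj c)"
  by transfer (auto simp: fun_eq_iff when_def)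

lemma ncadj_add: "ncadj (P + Q) = ncadj P + ncadj Q"
  by transfer auto

lemma ncadj_diff: "ncadj (P - Q) = ncadj P - ncadj Q"
  by transfer auto

lemma ncadj_zero [simp]: "ncadj 0 = 0"
  by transfer auto

lemma ncadj_one [simp]: "ncadj 1 = 1"
proof -
  have "ncadj (Poly_Mapping.single 0 1) = Poly_Mapping.single 0 1"
    by (simp add: ncadj_single adj_word_def zero_list_def del: single_one)
  then show ?thesis by simp
qed

lemma ncadj_ncadj [simp]: "ncadj (ncadj P) = P"
  by transfer auto

lemma ncpoly_induct [case_names zero single add]:
  fixes P :: "'n ncpoly"
  assumes "R 0" and "\<And>w c. R (Poly_Mapping.single w c)"
    and "\<And>P Q. R P \<Longrightarrow> R Q \<Longrightarrow> R (P + Q)"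
  shows "R P"
proof (induction P rule: update_induct)
  case const
  then show ?case by (rule assms(1))
next
  case (update P w c)
  have "Poly_Mapping.update w c P = P + Poly_Mapping.single w c"
    using update by (intro poly_mapping_eqI)
      (auto simp: lookup_update lookup_add lookup_single when_def in_keys_iff)
  then show ?case using assms(2,3) update by simp
qed

lemma ncadj_mult: "ncadj (P * Q) = ncadj Q * ncadj P"
proof (induction P rule: ncpoly_induct)
  case (single v c)
  show ?case
    by (induction Q rule: ncpoly_induct)
      (simp_all add: mult_single ncadj_single ncadj_add adj_word_add algebra_simps)
qed (simp_all add: ncadj_add algebra_simps)

lemma ncadj_scale: "ncadj (ncscale c P) = ncscale (cnj c) (ncadj P)"
proof -
  have "P * Poly_Mapping.single [] d = Poly_Mapping.single [] d * P" for P :: "'n ncpoly" and d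
    by (induction P rule: ncpoly_induct)
      (simp_all add: mult_single plus_list_def algebra_simps)
  then show ?thesis
    by (simp add: ncscale_def ncadj_mult ncadj_single adj_word_def)
qed

lemma ncadj_ncvar: "ncadj (ncvar i) = ncvar (swap_index i)"
  by (simp add: ncvar_def ncadj_single adj_word_def)

inductive_set analytic_polys :: "'n ncpoly set" where
  one: "1 \<in> analytic_polys"
| var: "ncvar (Inl k) \<in> analytic_polys"
| add: "P \<in> analytic_polys \<Longrightarrow> Q \<in> analytic_polys \<Longrightarrow> P + Q \<in> analytic_polys"
| scale: "P \<in> analytic_polys \<Longrightarrow> ncscale c P \<in> analytic_polys"
| mult: "P \<in> analytic_polys \<Longrightarrow> Q \<in> analytic_polys \<Longrightarrow> P * Q \<in> analytic_polys"

definition monomial :: "'n list \<Rightarrow> 'n ncpoly"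
  where "monomial \<sigma> = prod_list (map (\<lambda>k. ncvar (Inl k)) \<sigma>)"

definition isometry_relators :: "'n ncpoly set"
  where "isometry_relators = {1 - ncadj (ncvar (Inl k)) * ncvar (Inl k) | k. True}"

inductive_set two_sided_ideal :: "'a::ring_1 set \<Rightarrow> 'a set" for A :: "'a set" where
  zero: "0 \<in> two_sided_ideal A"
| gen: "a \<in> A \<Longrightarrow> a \<in> two_sided_ideal A"
| add: "x \<in> two_sided_ideal A \<Longrightarrow> y \<in> two_sided_ideal A \<Longrightarrow> x + y \<in> two_sided_ideal A"
| left: "x \<in> two_sided_ideal A \<Longrightarrow> r * x \<in> two_sided_ideal A"
| right: "x \<in> two_sided_ideal A \<Longrightarrow> x * r \<in> two_sided_ideal A"

lemma two_sided_ideal_uminus: "x \<in> two_sided_ideal A \<Longrightarrow> - x \<in> two_sided_ideal A"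
  using two_sided_ideal.left[of x A "- 1"] by simp

lemma two_sided_ideal_diff:
  "x \<in> two_sided_ideal A \<Longrightarrow> y \<in> two_sided_ideal A \<Longrightarrow> x - y \<in> two_sided_ideal A"
  using two_sided_ideal.add[of x A "- y"] two_sided_ideal_uminus[of y A] by simp

lemma ncadj_isometry_ideal:
  assumes "P \<in> two_sided_ideal isometry_relators"
  shows "ncadj P \<in> two_sided_ideal isometry_relators"
  using assms
proof induction
  case (gen a)
  then obtain k where "a = 1 - ncadj (ncvar (Inl k)) * ncvar (Inl k)"
    by (auto simp: isometry_relators_def)
  then have "ncadj a = a" by (simp add: ncadj_diff ncadj_mult)
  with gen show ?case by (simp add: two_sided_ideal.gen)
qed (auto simp: ncadj_add ncadj_mult intro: two_sided_ideal.intros)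

definition isometry_rel :: "'n ncpoly \<Rightarrow> 'n ncpoly \<Rightarrow> bool"
  where "isometry_rel P Q \<longleftrightarrow> P - Q \<in> two_sided_ideal isometry_relators"

lemma equivp_isometry_rel: "equivp isometry_rel"
proof (rule equivpI)
  show "reflp isometry_rel"
    by (simp add: reflp_def isometry_rel_def two_sided_ideal.zero)
  show "symp isometry_rel"
    unfolding symp_def isometry_rel_def using two_sided_ideal_uminus by fastforce
  show "transp isometry_rel"
    unfolding transp_def isometry_rel_def using two_sided_ideal.add by fastforce
qed

text \<open>The quotient algebra of the polynomials by the ideal generated by the \<open>1 - X\<^sub>k\<^sup>+ X\<^sub>k\<close>.\<close>

quotient_type 'n isom_alg = "'n ncpoly" / isometry_rel
  by (rule equivp_isometry_rel)

definition quot_map :: "'n ncpoly \<Rightarrow> 'n isom_alg"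
  where "quot_map = abs_isom_alg"

instantiation isom_alg :: (type) ring
begin

lift_definition zero_isom_alg :: "'a isom_alg" is 0 .

lift_definition plus_isom_alg :: "'a isom_alg \<Rightarrow> 'a isom_alg \<Rightarrow> 'a isom_alg" is "(+)"
  unfolding isometry_rel_def by (simp add: add_diff_add two_sided_ideal.add)

lift_definition uminus_isom_alg :: "'a isom_alg \<Rightarrow> 'a isom_alg" is uminus
  unfolding isometry_rel_def using two_sided_ideal_uminus by fastforce

lift_definition minus_isom_alg :: "'a isom_alg \<Rightarrow> 'a isom_alg \<Rightarrow> 'a isom_alg" is "(-)"
proof -
  fix P P' Q Q' :: "'a ncpoly"
  assume "isometry_rel P P'" "isometry_rel Q Q'"
  then have "(P - P') - (Q - Q') \<in> two_sided_ideal isometry_relators"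
    unfolding isometry_rel_def by (rule two_sided_ideal_diff)
  then show "isometry_rel (P - Q) (P' - Q')"
    by (simp add: isometry_rel_def algebra_simps)
qed

lift_definition times_isom_alg :: "'a isom_alg \<Rightarrow> 'a isom_alg \<Rightarrow> 'a isom_alg" is "(*)"
proof -
  fix P P' Q Q' :: "'a ncpoly"
  assume "isometry_rel P P'" "isometry_rel Q Q'"
  then have "P * (Q - Q') + (P - P') * Q' \<in> two_sided_ideal isometry_relators"
    unfolding isometry_rel_def by (intro two_sided_ideal.intros(3-5))
  then show "isometry_rel (P * Q) (P' * Q')"
    by (simp add: isometry_rel_def algebra_simps)
qed

instance
  by standard (transfer; simp add: algebra_simps isometry_rel_def two_sided_ideal.zero)+

end

lift_definition isom_scale :: "complex \<Rightarrow> 'n isom_alg \<Rightarrow> 'n isom_alg" is ncscale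
  unfolding isometry_rel_def ncscale_def
  by (metis right_diff_distrib two_sided_ideal.left)

lift_definition isom_adj :: "'n isom_alg \<Rightarrow> 'n isom_alg" is ncadj
  unfolding isometry_rel_def using ncadj_isometry_ideal by (metis ncadj_diff)

lemma quot_map_add: "quot_map (P + Q) = quot_map P + quot_map Q"
  by (simp add: quot_map_def plus_isom_alg.abs_eq)

lemma quot_map_mult: "quot_map (P * Q) = quot_map P * quot_map Q"
  by (simp add: quot_map_def times_isom_alg.abs_eq)

lemma quot_map_scale: "quot_map (ncscale c P) = isom_scale c (quot_map P)"
  by (simp add: quot_map_def isom_scale.abs_eq)

lemma quot_map_adj: "quot_map (ncadj P) = isom_adj (quot_map P)"
  by (simp add: quot_map_def isom_adj.abs_eq)

lemma quot_map_eq_iff: "quot_map P = quot_map Q \<longleftrightarrow> P - Q \<in> two_sided_ideal isometry_relators"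
  by (simp add: quot_map_def isom_alg.abs_eq_iff isometry_rel_def)

lemma surj_quot_map: "surj quot_map"
  unfolding quot_map_def by (rule surjI[where f = rep_isom_alg])
    (rule Quotient3_abs_rep[OF Quotient3_isom_alg])

lemma ncscale_simps:
  "ncscale c (P + Q) = ncscale c P + ncscale c Q"
  "ncscale (c + d) P = ncscale c P + ncscale d P"
  "ncscale c (ncscale d P) = ncscale (c * d) P"
  "ncscale 1 P = P"
proof -
  show "ncscale c (ncscale d P) = ncscale (c * d) P"
    by (simp add: ncscale_def mult_single plus_list_def flip: mult.assoc)
  show "ncscale 1 P = P"
    by (simp add: ncscale_def flip: zero_list_def)
qed (simp_all add: ncscale_def single_add distrib_left distrib_right)

lemma vector_space_isom_scale: "vector_space isom_scale"
proof
  fix a b :: complex and x y :: "'n isom_alg"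
  show "isom_scale a (x + y) = isom_scale a x + isom_scale a y"
    by transfer (simp add: ncscale_simps isometry_rel_def two_sided_ideal.zero)
  show "isom_scale (a + b) x = isom_scale a x + isom_scale b x"
    by transfer (simp add: ncscale_simps isometry_rel_def two_sided_ideal.zero)
  show "isom_scale a (isom_scale b x) = isom_scale (a * b) x"
    by transfer (simp add: ncscale_simps isometry_rel_def two_sided_ideal.zero)
  show "isom_scale 1 x = x"
    by transfer (simp add: ncscale_simps isometry_rel_def two_sided_ideal.zero)
qed

definition linear_functional :: "('n isom_alg \<Rightarrow> complex) \<Rightarrow> bool"
  where "linear_functional \<phi> \<longleftrightarrow> Vector_Spaces.linear isom_scale (*) \<phi>"

definition q_positive :: "('n isom_alg \<Rightarrow> complex) \<Rightarrow> bool"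
  where "q_positive \<phi> \<longleftrightarrow>
    (\<forall>P \<in> analytic_polys. \<phi> (isom_adj (quot_map P) * quot_map P) \<in> \<real>\<^sub>\<ge>\<^sub>0)"

definition moment_kernel :: "('n isom_alg \<Rightarrow> complex) \<Rightarrow> 'n list \<Rightarrow> 'n list \<Rightarrow> complex"
  where "moment_kernel \<phi> \<sigma> \<tau> =
    \<phi> (isom_adj (quot_map (monomial \<sigma>)) * quot_map (monomial \<tau>))"

text \<open>Finite families are indexed by \<open>{..<m}\<close>; their members need not be distinct.\<close>

definition positive_definite_kernel :: "('a \<Rightarrow> 'a \<Rightarrow> complex) \<Rightarrow> bool"
  where "positive_definite_kernel K \<longleftrightarrow>
    (\<forall>(m::nat) (s :: nat \<Rightarrow> 'a) (c :: nat \<Rightarrow> complex).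
      (\<Sum>p<m. \<Sum>q<m. K (s p) (s q) * cnj (c p) * c q) \<in> \<real>\<^sub>\<ge>\<^sub>0)"

definition invariant_kernel :: "('n list \<Rightarrow> 'n list \<Rightarrow> complex) \<Rightarrow> bool"
  where "invariant_kernel K \<longleftrightarrow> positive_definite_kernel K \<and>
    (\<forall>\<tau> \<sigma> \<sigma>'. K (\<tau> @ \<sigma>) (\<tau> @ \<sigma>') = K \<sigma> \<sigma>')"

end

theory Submission
  imports Defs
begin

text \<open>
  A linear functional on the free algebra is an arbitrary function \<open>f\<close> on words, and it descends to
  the quotient iff \<open>f\<close> does not change when a factor \<open>X\<^sub>k\<^sup>+ X\<^sub>k\<close> is deleted from a word. Given an
  invariant kernel \<open>K\<close>, cancel all such factors from a word and evaluate \<open>K\<close> on the starred and the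
  unstarred letters that remain; invariance of \<open>K\<close> is what makes the value at \<open>X\<^sub>\<sigma>\<^sup>+ X\<^sub>\<tau>\<close> equal to
  \<open>K \<sigma> \<tau>\<close>. Positivity matches in both directions, because the elements of \<open>\<P>\<^sub>N\<close> are exactly the
  combinations \<open>\<Sum> c\<^sub>p X\<^bsub>\<sigma>\<^sub>p\<^esub>\<close> and \<open>\<phi>(\<pi>(P)\<^sup>+ \<pi>(P))\<close> is the corresponding quadratic form of \<open>K\<^sub>\<phi>\<close>.
\<close>

section \<open>Analytic polynomials\<close>

lemma monomial_eq_single: "monomial \<sigma> = Poly_Mapping.single (map Inl \<sigma>) 1"
proof (induction \<sigma>)
  case Nil
  have "(1 :: 'a ncpoly) = Poly_Mapping.single 0 1" by simp
  then show ?case by (simp add: monomial_def zero_list_def)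
next
  case (Cons k \<sigma>)
  have "monomial (k # \<sigma>) = ncvar (Inl k) * monomial \<sigma>"
    by (simp add: monomial_def)
  then show ?case
    by (simp add: Cons ncvar_def mult_single plus_list_def)
qed

lemma ncscale_monomial: "ncscale c (monomial \<sigma>) = Poly_Mapping.single (map Inl \<sigma>) c"
  by (simp add: monomial_eq_single ncscale_def mult_single plus_list_def)

lemma monomial_in_analytic_polys: "monomial \<sigma> \<in> analytic_polys"
  by (induction \<sigma>) (auto simp: monomial_def intro: analytic_polys.intros)

lemma zero_in_analytic_polys: "0 \<in> analytic_polys"
  using analytic_polys.scale[OF analytic_polys.one, of 0] by (simp add: ncscale_def)

lemma sum_in_analytic_polys:
  "(\<And>i. i \<in> I \<Longrightarrow> F i \<in> analytic_polys) \<Longrightarrow> sum F I \<in> analytic_polys"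
  by (induction I rule: infinite_finite_induct)
    (auto intro: analytic_polys.add zero_in_analytic_polys)

lemma keys_ncscale_subset: "Poly_Mapping.keys (ncscale c P) \<subseteq> Poly_Mapping.keys P"
  using keys_mult[of "Poly_Mapping.single [] c" P]
  by (auto simp: ncscale_def plus_list_def split: if_splits)

text \<open>Words in unstarred letters include the empty word and are closed under concatenation, so
  the polynomials supported on them form a subalgebra that contains the generators.\<close>

lemma keys_analytic_poly: "P \<in> analytic_polys \<Longrightarrow> Poly_Mapping.keys P \<subseteq> range (map Inl)"
proof (induction rule: analytic_polys.induct)
  case one
  have "[] = map Inl []" by simp
  then show ?case by (simp add: zero_list_def)
next
  case (var k)
  have "[Inl k] \<in> range (map Inl)" by (rule range_eqI[of _ _ "[k]"]) simp
  then show ?case by (simp add: ncvar_def)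
next
  case (add P Q)
  then show ?case using keys_add[of P Q] by blast
next
  case (scale P c)
  then show ?case using keys_ncscale_subset[of c P] by blast
next
  case (mult P Q)
  show ?case
  proof
    fix w assume "w \<in> Poly_Mapping.keys (P * Q)"
    then obtain u v where "w = u @ v" "u \<in> Poly_Mapping.keys P" "v \<in> Poly_Mapping.keys Q"
      using keys_mult[of P Q] by (auto simp: plus_list_def)
    with mult.IH obtain \<sigma> \<tau> where "w = map Inl \<sigma> @ map Inl \<tau>" by blast
    then have "w = map Inl (\<sigma> @ \<tau>)" by simp
    then show "w \<in> range (map Inl)" by (rule range_eqI)
  qed
qed

lemma poly_mapping_eq_sum_single:
  "P = (\<Sum>w\<in>Poly_Mapping.keys P. Poly_Mapping.single w (Poly_Mapping.lookup P w))"
  by (rule poly_mapping_eqI)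
    (auto simp: lookup_sum lookup_single when_def in_keys_iff if_distrib cong: if_cong)

text \<open>Enumerating the finite support by \<open>{..<m}\<close> gives the expansion the shape of
  the families in \<open>positive_definite_kernel\<close>.\<close>

lemma analytic_poly_expansion:
  assumes "P \<in> analytic_polys"
  obtains m :: nat and s c where "P = (\<Sum>p<m. ncscale (c p) (monomial (s p)))"
proof -
  obtain h where h: "bij_betw h {0..<card (Poly_Mapping.keys P)} (Poly_Mapping.keys P)"
    using ex_bij_betw_nat_finite[OF finite_keys] by blast
  have "\<exists>\<sigma>. h p = map Inl \<sigma>" if "p < card (Poly_Mapping.keys P)" for p
    using that bij_betwE[OF h] keys_analytic_poly[OF assms] by fastforce
  then obtain s where s: "h p = map Inl (s p)" if "p < card (Poly_Mapping.keys P)" for p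
    by metis
  have "P = (\<Sum>w\<in>Poly_Mapping.keys P. Poly_Mapping.single w (Poly_Mapping.lookup P w))"
    by (rule poly_mapping_eq_sum_single)
  also have "\<dots> = (\<Sum>p<card (Poly_Mapping.keys P).
      Poly_Mapping.single (h p) (Poly_Mapping.lookup P (h p)))"
    by (simp add: sum.reindex_bij_betw[OF h, symmetric] atLeast0LessThan)
  also have "\<dots> = (\<Sum>p<card (Poly_Mapping.keys P).
      ncscale (Poly_Mapping.lookup P (h p)) (monomial (s p)))"
    by (intro sum.cong) (simp_all add: ncscale_monomial s)
  finally show thesis by (rule that)
qed

section \<open>Functionals and their moment kernels\<close>

lemma ncadj_sum: "ncadj (sum F I) = (\<Sum>i\<in>I. ncadj (F i))"
  by (induction I rule: infinite_finite_induct) (simp_all add: ncadj_add)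

lemma moment_kernel_eq: "moment_kernel \<phi> \<sigma> \<tau> = \<phi> (quot_map (ncadj (monomial \<sigma>) * monomial \<tau>))"
  by (simp add: moment_kernel_def quot_map_mult quot_map_adj)

text \<open>Surjectivity of \<open>quot_map\<close> allows linearity to be tested on
  representatives.\<close>

lemma linear_functional_iff:
  "linear_functional \<phi> \<longleftrightarrow>
    (\<forall>P Q. \<phi> (quot_map (P + Q)) = \<phi> (quot_map P) + \<phi> (quot_map Q)) \<and>
    (\<forall>c P. \<phi> (quot_map (ncscale c P)) = c * \<phi> (quot_map P))"
proof -
  have "vector_space ((*) :: complex \<Rightarrow> complex \<Rightarrow> complex)"
    by standard (simp_all add: algebra_simps)
  then have "linear_functional \<phi> \<longleftrightarrow>
    (\<forall>x y. \<phi> (x + y) = \<phi> x + \<phi> y) \<and> (\<forall>c x. \<phi> (isom_scale c x) = c * \<phi> x)"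
    by (simp add: linear_functional_def Vector_Spaces.linear_iff vector_space_isom_scale)
  then show ?thesis
    by (metis quot_map_add quot_map_scale surjD[OF surj_quot_map])
qed

lemma ncscale_mult_left: "ncscale c P * Q = ncscale c (P * Q)"
  by (simp add: ncscale_def mult.assoc)

lemma ncscale_mult_right: "P * ncscale c Q = ncscale c (P * Q)"
proof -
  have "P * Poly_Mapping.single [] c = Poly_Mapping.single [] c * P"
    by (induction P rule: ncpoly_induct)
      (simp_all add: mult_single plus_list_def algebra_simps)
  then show ?thesis by (simp add: ncscale_def flip: mult.assoc)
qed

lemma quadratic_form_eq:
  fixes m :: nat
  assumes "linear_functional \<phi>"
  defines "P c s \<equiv> \<Sum>p<m. ncscale (c p) (monomial (s p))"
  shows "\<phi> (isom_adj (quot_map (P c s)) * quot_map (P c s)) =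
    (\<Sum>p<m. \<Sum>q<m. moment_kernel \<phi> (s p) (s q) * cnj (c p) * c q)"
proof -
  have lin: "\<phi> (quot_map (P + Q)) = \<phi> (quot_map P) + \<phi> (quot_map Q)"
    "\<phi> (quot_map (ncscale c P)) = c * \<phi> (quot_map P)" for P Q c
    using assms(1) by (auto simp: linear_functional_iff)
  have zero: "\<phi> (quot_map 0) = 0"
    using lin(1)[of 0 0] by simp
  have sum: "\<phi> (quot_map (sum F I)) = (\<Sum>i\<in>I. \<phi> (quot_map (F i)))" for F and I :: "nat set"
    by (induction I rule: infinite_finite_induct) (simp_all add: lin zero)
  have "\<phi> (isom_adj (quot_map (P c s)) * quot_map (P c s)) =
    \<phi> (quot_map (ncadj (P c s) * P c s))"
    by (simp add: quot_map_mult quot_map_adj)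
  also have "\<dots> = (\<Sum>p<m. \<Sum>q<m. moment_kernel \<phi> (s p) (s q) * cnj (c p) * c q)"
    by (simp add: P_def ncadj_sum sum_product ncadj_scale ncscale_mult_left ncscale_mult_right
        ncscale_simps sum lin moment_kernel_eq algebra_simps)
  finally show ?thesis .
qed

text \<open>Both conditions test the same numbers, by \<open>quadratic_form_eq\<close>: combinations
  of monomials are analytic, and \<open>analytic_poly_expansion\<close> says that every analytic
  polynomial is one.\<close>

lemma q_positive_iff_positive_definite:
  assumes "linear_functional \<phi>"
  shows "q_positive \<phi> \<longleftrightarrow> positive_definite_kernel (moment_kernel \<phi>)"
proof
  assume "q_positive \<phi>"
  then show "positive_definite_kernel (moment_kernel \<phi>)"
    unfolding positive_definite_kernel_def q_positive_def
    by (metis (no_types, lifting) quadratic_form_eq[OF assms] sum_in_analytic_polys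
        analytic_polys.scale monomial_in_analytic_polys)
next
  assume pd: "positive_definite_kernel (moment_kernel \<phi>)"
  show "q_positive \<phi>"
    unfolding q_positive_def
  proof
    fix P :: "'a ncpoly" assume "P \<in> analytic_polys"
    then obtain m :: nat and s c where "P = (\<Sum>p<m. ncscale (c p) (monomial (s p)))"
      by (rule analytic_poly_expansion)
    with pd show "\<phi> (isom_adj (quot_map P) * quot_map P) \<in> \<real>\<^sub>\<ge>\<^sub>0"
      by (simp add: quadratic_form_eq[OF assms] positive_definite_kernel_def)
  qed
qed

lemma quot_map_isometry: "quot_map (ncadj (ncvar (Inl k)) * ncvar (Inl k)) = quot_map 1"
proof -
  have "1 - ncadj (ncvar (Inl k)) * ncvar (Inl k) \<in> two_sided_ideal isometry_relators"
    by (rule two_sided_ideal.gen) (auto simp: isometry_relators_def)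
  then show ?thesis
    by (metis quot_map_eq_iff)
qed

lemma moment_kernel_invariant:
  "moment_kernel \<phi> (\<tau> @ \<sigma>) (\<tau> @ \<sigma>') = moment_kernel \<phi> \<sigma> \<sigma>'"
proof (induction \<tau>)
  case (Cons k \<tau>)
  let ?X = "ncvar (Inl k) :: 'a ncpoly"
  \<comment> \<open>One letter of the common prefix is removed at a time: the two copies of
    \<open>?X\<close> meet in the middle as \<open>ncadj ?X * ?X\<close>, which is 1 in the
    quotient.\<close>
  have "quot_map (ncadj (?X * A) * (?X * B)) = quot_map (ncadj A * B)" for A B
  proof -
    have "quot_map (ncadj (?X * A) * (?X * B)) =
      quot_map (ncadj A) * quot_map (ncadj ?X * ?X) * quot_map B"
      by (simp add: ncadj_mult mult.assoc flip: quot_map_mult)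
    also have "\<dots> = quot_map (ncadj A * B)"
      by (simp add: quot_map_isometry flip: quot_map_mult)
    finally show ?thesis .
  qed
  then show ?case
    using Cons by (simp add: moment_kernel_eq monomial_def)
qed simp

section \<open>The functional of an invariant kernel\<close>

definition linear_extension :: "('a \<Rightarrow> complex) \<Rightarrow> ('a \<Rightarrow>\<^sub>0 complex) \<Rightarrow> complex"
  where "linear_extension f P = (\<Sum>w\<in>Poly_Mapping.keys P. Poly_Mapping.lookup P w * f w)"

lemma linear_extension_superset:
  assumes "finite A" "Poly_Mapping.keys P \<subseteq> A"
  shows "linear_extension f P = (\<Sum>w\<in>A. Poly_Mapping.lookup P w * f w)"
  unfolding linear_extension_def using assms
  by (intro sum.mono_neutral_left) (auto simp: in_keys_iff)

lemma linear_extension_add: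
  "linear_extension f (P + Q) = linear_extension f P + linear_extension f Q"
proof -
  have "Poly_Mapping.keys (P + Q) \<subseteq> Poly_Mapping.keys P \<union> Poly_Mapping.keys Q"
    by (rule keys_add)
  then show ?thesis
    by (simp add: linear_extension_superset[of "Poly_Mapping.keys P \<union> Poly_Mapping.keys Q"]
        lookup_add distrib_right sum.distrib)
qed

lemma linear_extension_zero: "linear_extension f 0 = 0"
  by (simp add: linear_extension_def)

lemma linear_extension_diff:
  "linear_extension f (P - Q) = linear_extension f P - linear_extension f Q"
  using linear_extension_add[of f "P - Q" Q] by simp

lemma linear_extension_single: "linear_extension f (Poly_Mapping.single w c) = c * f w"
  by (simp add: linear_extension_def)

lemma linear_extension_ncscale: "linear_extension f (ncscale c P) = c * linear_extension f P"
  by (induction P rule: ncpoly_induct)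
    (simp_all add: ncscale_def mult_single plus_list_def distrib_left linear_extension_zero
      linear_extension_single linear_extension_add)

lemma linear_extension_ideal:
  assumes f: "\<And>u k v. f (u @ [Inr k, Inl k] @ v) = f (u @ v)"
    and "x \<in> two_sided_ideal isometry_relators"
  shows "linear_extension f x = 0"
proof -
  \<comment> \<open>The factors \<open>P\<close> and \<open>Q\<close> strengthen the induction:
    multiplication of \<open>x\<close> from either side is absorbed into them. For a generator,
    bilinearity reduces both to multiples of words, where \<open>f\<close> applies.\<close>
  have "linear_extension f (P * x * Q) = 0" for P Q
    using assms(2)
  proof (induction arbitrary: P Q)
    case (gen x)
    then obtain k where "x = 1 - ncadj (ncvar (Inl k)) * ncvar (Inl k)"
      by (auto simp: isometry_relators_def)
    moreover have "(1 :: 'a ncpoly) = Poly_Mapping.single [] 1"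
      by (simp flip: zero_list_def)
    ultimately have x: "x = Poly_Mapping.single [] 1 - Poly_Mapping.single [Inr k, Inl k] 1"
      by (simp add: ncvar_def ncadj_single adj_word_def mult_single plus_list_def)
    show ?case
    proof (induction P rule: ncpoly_induct)
      case (single u c)
      show ?case
      proof (induction Q rule: ncpoly_induct)
        case (single v d)
        have "Poly_Mapping.single u c * x * Poly_Mapping.single v d =
          Poly_Mapping.single (u @ v) (c * d) -
          Poly_Mapping.single (u @ [Inr k, Inl k] @ v) (c * d)"
          by (simp add: x left_diff_distrib right_diff_distrib mult_single plus_list_def)
        then show ?case
          by (simp only: linear_extension_diff linear_extension_single f) simp
      qed (simp_all add: linear_extension_zero linear_extension_add distrib_left)
    qed (simp_all add: linear_extension_zero linear_extension_add distrib_right)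
  next
    case zero
    show ?case by (simp add: linear_extension_zero)
  next
    case (add x y)
    then show ?case by (simp add: linear_extension_add distrib_left distrib_right)
  next
    case (left x r)
    then show ?case using left.IH[of "P * r" Q] by (simp add: mult.assoc)
  next
    case (right x r)
    then show ?case using right.IH[of P "r * Q"] by (simp add: mult.assoc)
  qed
  from this[of 1 1] show ?thesis by simp
qed

lemma linear_functional_of_word_function:
  assumes "\<And>u k v. f (u @ [Inr k, Inl k] @ v) = f (u @ v)"
  obtains \<phi> where "linear_functional \<phi>"
    and "\<And>\<sigma> \<tau>. moment_kernel \<phi> \<sigma> \<tau> = f (adj_word (map Inl \<sigma>) @ map Inl \<tau>)"
proof -
  \<comment> \<open>The choice of representative does not matter: two of them differ by an element
    of the ideal, where the extension vanishes.\<close>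
  define \<phi> where "\<phi> x = linear_extension f (rep_isom_alg x)" for x
  have \<phi>: "\<phi> (quot_map P) = linear_extension f P" for P
  proof -
    have "quot_map (rep_isom_alg (quot_map P)) = quot_map P"
      unfolding quot_map_def by (rule Quotient3_abs_rep[OF Quotient3_isom_alg])
    then have "linear_extension f (rep_isom_alg (quot_map P) - P) = 0"
      by (intro linear_extension_ideal assms) (simp add: quot_map_eq_iff)
    then show ?thesis
      by (simp add: \<phi>_def linear_extension_diff)
  qed
  show thesis
  proof (rule that)
    show "linear_functional \<phi>"
      by (simp add: linear_functional_iff \<phi> linear_extension_add linear_extension_ncscale)
    show "moment_kernel \<phi> \<sigma> \<tau> = f (adj_word (map Inl \<sigma>) @ map Inl \<tau>)" for \<sigma> \<tau>
      by (simp add: moment_kernel_eq \<phi> monomial_eq_single ncadj_single mult_single plus_list_def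
          linear_extension_single)
  qed
qed

section \<open>Cancellation in words\<close>

fun cancel_cons :: "'n + 'n \<Rightarrow> ('n + 'n) list \<Rightarrow> ('n + 'n) list" where
  "cancel_cons (Inr k) (Inl l # w) = (if k = l then w else Inr k # Inl l # w)"
| "cancel_cons i w = i # w"

text \<open>One pass from the right suffices: each letter is put in front of a word that is already
  reduced, so a new factor \<open>[Inr k, Inl k]\<close> can only arise at its head.\<close>

definition cancel :: "('n + 'n) list \<Rightarrow> ('n + 'n) list"
  where "cancel w = foldr cancel_cons w []"

lemma cancel_cons_Inl [simp]: "cancel_cons (Inl k) w = Inl k # w"
  by (cases w) auto

text \<open>After \<open>v\<close> is processed, \<open>Inl k\<close> is always prepended and
  \<open>Inr k\<close> removes it at once, so \<open>u\<close> meets the same word on both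
  sides.\<close>

lemma cancel_relator: "cancel (u @ [Inr k, Inl k] @ v) = cancel (u @ v)"
  by (simp add: cancel_def)

lemma foldr_cancel_cons_Inl: "foldr cancel_cons (map Inl \<tau>) w = map Inl \<tau> @ w"
  by (induction \<tau>) simp_all

text \<open>A starred letter cancels only directly in front of an unstarred one, so a surviving
  \<open>Inr k\<close> shields all starred letters to its left.\<close>

lemma foldr_cancel_cons_Inr:
  "foldr cancel_cons (map Inr \<rho>) (Inr k # w) = map Inr \<rho> @ Inr k # w"
  by (induction \<rho>) (simp, (case_tac \<rho>; simp))

lemma adj_word_Inl: "adj_word (map Inl \<sigma>) = map Inr (rev \<sigma>)"
  by (simp add: adj_word_def rev_map)

text \<open>
  Only words in which the starred letters precede the unstarred ones matter; the value at the
  others is irrelevant.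
\<close>

definition word_value :: "('n list \<Rightarrow> 'n list \<Rightarrow> complex) \<Rightarrow> ('n + 'n) list \<Rightarrow> complex"
  where "word_value K w = K (rev (map projr (filter (Not \<circ> isl) w))) (map projl (filter isl w))"

lemma word_value_split: "word_value K (map Inr (rev \<sigma>) @ map Inl \<tau>) = K \<sigma> \<tau>"
  by (simp add: word_value_def filter_map o_def rev_map)

lemma word_value_cancel:
  assumes inv: "\<And>\<rho> \<sigma> \<tau>. K (\<rho> @ \<sigma>) (\<rho> @ \<tau>) = K \<sigma> \<tau>"
  shows "word_value K (cancel (adj_word (map Inl \<sigma>) @ map Inl \<tau>)) = K \<sigma> \<tau>"
proof (induction \<sigma> arbitrary: \<tau>)
  case Nil
  show ?case
    using word_value_split[of K "[]" \<tau>]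
    by (simp add: adj_word_def cancel_def foldr_cancel_cons_Inl)
next
  case (Cons k \<sigma>)
  show ?case
  \<comment> \<open>The adjoint reverses the word, so the star of the first letter \<open>k\<close>
    stands next to the first letter of \<open>\<tau>\<close>. If they agree, the pair cancels and
    invariance under the prefix \<open>[k]\<close> restores it in \<open>K\<close>; otherwise the
    word is already reduced.\<close>
  proof (cases "\<exists>\<tau>'. \<tau> = k # \<tau>'")
    case True
    then obtain \<tau>' where \<tau>: "\<tau> = k # \<tau>'" by blast
    have "cancel (adj_word (map Inl (k # \<sigma>)) @ map Inl \<tau>) =
      cancel (adj_word (map Inl \<sigma>) @ map Inl \<tau>')"
      using cancel_relator[of "map Inr (rev \<sigma>)" k "map Inl \<tau>'"]
        adj_word_Inl[of "k # \<sigma>"] adj_word_Inl[of \<sigma>]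
      by (simp add: \<tau>)
    then show ?thesis
      using Cons.IH inv[of "[k]"] by (simp add: \<tau>)
  next
    case False
    then have "cancel_cons (Inr k) (map Inl \<tau>) = Inr k # map Inl \<tau>"
      by (cases \<tau>) auto
    then have "cancel (adj_word (map Inl (k # \<sigma>)) @ map Inl \<tau>) =
      map Inr (rev (k # \<sigma>)) @ map Inl \<tau>"
      using adj_word_Inl[of "k # \<sigma>"]
      by (simp add: cancel_def foldr_cancel_cons_Inl foldr_cancel_cons_Inr)
    then show ?thesis
      by (simp only: word_value_split)
  qed
qed

theorem theorem3p3:
  fixes K :: "'n::finite list \<Rightarrow> 'n list \<Rightarrow> complex"
  shows "(\<exists>\<phi> :: 'n isom_alg \<Rightarrow> complex.
            linear_functional \<phi> \<and> q_positive \<phi> \<and> K = moment_kernel \<phi>)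
         \<longleftrightarrow> invariant_kernel K"
proof
  assume "\<exists>\<phi>. linear_functional \<phi> \<and> q_positive \<phi> \<and> K = moment_kernel \<phi>"
  then show "invariant_kernel K"
    by (auto simp: invariant_kernel_def moment_kernel_invariant q_positive_iff_positive_definite)
next
  assume K: "invariant_kernel K"
  \<comment> \<open>Cancelling first makes \<open>f\<close> insensitive to deleted factors, as
    descent to the quotient requires.\<close>
  define f where "f w = word_value K (cancel w)" for w
  have "f (u @ [Inr k, Inl k] @ v) = f (u @ v)" for u k v
    by (simp only: f_def cancel_relator)
  then obtain \<phi> where \<phi>: "linear_functional \<phi>"
    and "\<And>\<sigma> \<tau>. moment_kernel \<phi> \<sigma> \<tau> = f (adj_word (map Inl \<sigma>) @ map Inl \<tau>)"
    using linear_functional_of_word_function[of f] by blast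
  then have "moment_kernel \<phi> = K"
    using K by (auto simp: fun_eq_iff f_def word_value_cancel invariant_kernel_def)
  with K \<phi> show "\<exists>\<phi>. linear_functional \<phi> \<and> q_positive \<phi> \<and> K = moment_kernel \<phi>"
    by (auto simp: invariant_kernel_def q_positive_iff_positive_definite)
qed

end
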